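(* Let $m$ be an odd positive integer and let $f(x)=x^{-4}+x^6+x$. Then $f$ induces a $(0,1,4)$-map over $\mathbb{F}_{2^m}$, and furthermore $|D(f)^*|=2^{m-1}$.
   Context: $f$ is regarded as a function on $\mathbb{F}_{2^m}$ with values in $\mathbb{F}_{2^m}$, with the convention $f(0)=0$ (i.e. negative powers of $0$ are $0$). A function $F:X\to Y$ is called a $(0,1,a)$-map if for every $y\in Y$ the number of $x\in X$ with $F(x)=y$ belongs to $\{0,1,a\}$. $D(f)^*=\{f(x):x\in\mathbb{F}_{2^m}^*\}\setminus\{0\}$. *)

theory Defs
  imports Complex_Main "HOL-Library.Cardinality"
begin

(* The finiteness conjunct excludes infinite fibres, whose card would be 0 by convention. *)
definition zero_one_map :: "nat \<Rightarrow> ('a \<Rightarrow> 'b) \<Rightarrow> 'a set \<Rightarrow> 'b set \<Rightarrow> bool" where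
  "zero_one_map a F X Y \<longleftrightarrow> F ` X \<subseteq> Y \<and>
     (\<forall>y\<in>Y. finite {x \<in> X. F x = y} \<and> card {x \<in> X. F x = y} \<in> {0, 1, a})"

definition D_star :: "('a::field \<Rightarrow> 'a) \<Rightarrow> 'a set" where
  "D_star f = {f x | x. x \<noteq> 0} - {0}"

definition f_map :: "'a::field \<Rightarrow> 'a" where
  "f_map x = x powi (-4) + x ^ 6 + x"

(* Negative powers of 0 are 0 in the library. *)
lemma f_map_0: "f_map 0 = 0"
  by (simp add: f_map_def)

end

theory Submission
  imports Defs "HOL-Computational_Algebra.Primes"
begin

text \<open>
  Write \<open>q = 2 ^ m\<close>, and let \<open>A\<close> be the additive subgroup of the elements \<open>w\<^sup>2 + w\<close>
  (the elements of absolute trace 0).  It has index two, and \<open>1 \<notin> A\<close> because \<open>m\<close> is odd.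
  The idea is that every fibre of \<open>f\<close> over a nonzero value contains exactly one point \<open>x\<close> with
  \<open>x ^ 5 \<notin> A\<close>, and that the rest of the fibre can be read off from this point.

  Where this comes from: over an algebraic closure, the solutions of \<open>f x = y\<close> with \<open>y \<noteq> 0\<close> are the
  ten numbers \<open>1 / (v\<^sub>i + v\<^sub>j)\<close>, where \<open>v\<^sub>1, \<dots>, v\<^sub>5\<close> are the roots of the quintic \<open>v ^ 5 + y v + 1\<close>.
  If \<open>x\<close> belongs to the pair \<open>i, j\<close>, then \<open>v\<^sub>i = w / x\<close> and \<open>v\<^sub>j = (w + 1) / x\<close> with
  \<open>w\<^sup>2 + w = x ^ 5\<close>, so for \<open>x\<close> in the field, \<open>x ^ 5 \<notin> A\<close> says
  that the Frobenius map \<open>v \<mapsto> v ^ q\<close> interchanges \<open>v\<^sub>i\<close> and \<open>v\<^sub>j\<close>.  For odd \<open>m\<close>,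
  it permutes the five roots oddly, hence with cycle type (2,1,1,1), (2,3) or (4,1);
  it then fixes 4, 1 or 0 of the ten pairs, and in the first two cases it interchanges the members
  of exactly one of them.

  The proof carries this out inside the field, with polynomials in the ratio \<open>s = x / x'\<close> of two
  nonzero solutions.  With \<open>p = x ^ 5\<close>, the equation \<open>f (x / s) = f x\<close> factors as
  \<open>(s + 1) (s ^ 3 + p s + p) H = 0\<close> with a sextic \<open>H\<close> (lemma \<open>f_map_divide_eq_iff\<close>): the cubic
  stands for the pairs disjoint from the given one, the sextic for the pairs that share one index with it.
  Four facts suffice.

    \<^item> A root of \<open>H\<close> forces \<open>p \<in> A\<close>.
    \<^item> If \<open>s\<close> is a root of the cubic, then exactly one of \<open>x ^ 5\<close> and \<open>(x / s) ^ 5\<close> lies in \<open>A\<close>.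
    \<^item> If \<open>p \<in> A\<close>, the cubic has a root, by Cardano's formula.
    \<^item> If \<open>p \<notin> A\<close>, the cubic has 0 or 3 roots.

  The first two show that a fibre contains at most one \<open>x\<close> with \<open>x ^ 5 \<notin> A\<close>, the second and third
  that it contains one.  For that \<open>x\<close>, the fibre consists of \<open>x\<close> and of the \<open>x / s\<close> for the 0 or
  3 roots \<open>s\<close> of the cubic, so it has 1 or 4 elements.  Finally, the nonzero values of \<open>f\<close>
  correspond to the \<open>x\<close> with \<open>x ^ 5 \<notin> A\<close>; there are \<open>q / 2\<close> of them, since 5 is coprime to
  \<open>q - 1\<close> and so the fifth power is a permutation.
\<close>

section \<open>Finite fields of characteristic two\<close>

text \<open>
  Translation by 1 permutes the field, so the sum of all elements does not change when
  \<open>CARD('a)\<close> ones are added to it.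
\<close>

lemma two_eq_zero:
  assumes "CARD('a::{field,finite}) = 2 ^ m"
  shows "(2::'a) = 0"
proof -
  have "(of_nat (CARD('a)) :: 'a) = 0"
  proof -
    have "(\<Sum>x\<in>(UNIV :: 'a set). x) = (\<Sum>x\<in>(UNIV :: 'a set). x + 1)"
      by (rule sum.reindex_bij_witness[of _ "\<lambda>x. x + 1" "\<lambda>x. x - 1"]) auto
    then show ?thesis by (simp add: sum.distrib)
  qed
  then have "(2::'a) ^ m = 0" by (simp add: assms)
  then show ?thesis by simp
qed

lemma add_eq_zero_iff_char2:
  fixes a b :: "'a::field"
  assumes "(2::'a) = 0"
  shows "a + b = 0 \<longleftrightarrow> a = b"
proof -
  have "b + b = 0" using assms by (metis mult_2 mult_zero_left)
  then show ?thesis by (metis add_right_cancel)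
qed

text \<open>
  A quotient \<open>z\<close> of two elements with the same \<open>k\<close>-th power satisfies \<open>z ^ k = 1\<close> and
  \<open>z ^ (q - 1) = 1\<close>, and 1 is an integer combination of the two exponents.
\<close>

lemma power_inj_of_coprime:
  fixes x y :: "'a::{field,finite}"
  assumes "coprime k (CARD('a) - 1)" and "k > 0" and "x ^ k = y ^ k"
  shows "x = y"
proof (cases "y = 0")
  case True
  with assms(2,3) show ?thesis by (simp add: power_0_left)
next
  case False
  define z where "z = x / y"
  have z: "z ^ k = 1" using assms(3) False by (simp add: z_def power_divide)
  then have z0: "z \<noteq> 0" using \<open>k > 0\<close> by (metis power_0_left less_numeral_extra(3) zero_neq_one)
  \<comment> \<open>Multiplication by \<open>z\<close> permutes the nonzero elements, so their product absorbs \<open>z ^ (q - 1)\<close>.\<close>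
  have "\<Prod>(UNIV - {0::'a}) = (\<Prod>x\<in>UNIV - {0}. z * x)"
    by (rule prod.reindex_bij_witness[of _ "\<lambda>x. z * x" "\<lambda>x. x / z"]) (auto simp: z0)
  also have "\<dots> = z ^ (CARD('a) - 1) * \<Prod>(UNIV - {0::'a})"
    by (simp add: prod.distrib card_Diff_singleton)
  finally have zq: "z ^ (CARD('a) - 1) = 1" by simp
  obtain a b where "k * a = (CARD('a) - 1) * b + gcd k (CARD('a) - 1)"
    using bezout_nat[of k "CARD('a) - 1"] \<open>k > 0\<close> by blast
  then have ab: "k * a = (CARD('a) - 1) * b + 1" using assms(1) by simp
  have "1 = z ^ (k * a)" by (simp add: power_mult z)
  also have "\<dots> = z" using zq by (simp add: ab power_add power_mult)
  finally show ?thesis using False by (simp add: z_def field_simps)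
qed

text \<open>The next two lemmas make cubing and the fifth power permutations of the field.\<close>

lemma coprime_3_pow2_odd:
  assumes "odd m"
  shows "coprime 3 (2 ^ m - 1 :: nat)"
proof -
  obtain n where m: "m = 2 * n + 1" using assms by (elim oddE)
  have "(2::nat) ^ (2 * n + 1) mod 3 = 2"
  proof (induction n)
    case (Suc n)
    have "(2::nat) ^ (2 * Suc n + 1) = 4 * 2 ^ (2 * n + 1)" by simp
    with Suc show ?case by presburger
  qed simp
  then have "\<not> 3 dvd (2 ^ m - 1 :: nat)" unfolding m by presburger
  moreover have "prime (3::nat)" by simp
  ultimately show ?thesis using prime_imp_coprime by blast
qed

lemma coprime_5_pow2_odd:
  assumes "odd m"
  shows "coprime 5 (2 ^ m - 1 :: nat)"
proof -
  obtain n where m: "m = 2 * n + 1" using assms by (elim oddE)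
  have "(2::nat) ^ (2 * n + 1) mod 5 = 2 \<or> (2::nat) ^ (2 * n + 1) mod 5 = 3"
  proof (induction n)
    case (Suc n)
    have "(2::nat) ^ (2 * Suc n + 1) = 4 * 2 ^ (2 * n + 1)" by simp
    with Suc show ?case by presburger
  qed simp
  then have "\<not> 5 dvd (2 ^ m - 1 :: nat)" unfolding m by presburger
  moreover have "prime (5::nat)" by simp
  ultimately show ?thesis using prime_imp_coprime by blast
qed

section \<open>The Artin-Schreier subgroup\<close>

definition artin_schreier_image :: "'a::field set" where
  "artin_schreier_image = range (\<lambda>w. w\<^sup>2 + w)"

lemma artin_schreierI: "w\<^sup>2 + w \<in> artin_schreier_image"
  by (simp add: artin_schreier_image_def)

lemma artin_schreier_add:
  fixes a b :: "'a::field"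
  assumes "(2::'a) = 0" and "a \<in> artin_schreier_image" and "b \<in> artin_schreier_image"
  shows "a + b \<in> artin_schreier_image"
proof -
  obtain u v where "a = u\<^sup>2 + u" "b = v\<^sup>2 + v"
    using assms(2,3) by (auto simp: artin_schreier_image_def)
  moreover have "(u + v)\<^sup>2 + (u + v) = (u\<^sup>2 + u) + (v\<^sup>2 + v) + 2 * (u * v)" by algebra
  ultimately have "a + b = (u + v)\<^sup>2 + (u + v)" by (simp add: assms(1))
  then show ?thesis using artin_schreierI[of "u + v"] by simp
qed

text \<open>The map \<open>w \<mapsto> w\<^sup>2 + w\<close> is two-to-one: its fibres are the pairs \<open>{u, u + 1}\<close>.\<close>

lemma card_artin_schreier:
  assumes "(2::'a::{field,finite}) = 0"
  shows "2 * card (artin_schreier_image :: 'a set) = CARD('a)"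
proof -
  have fib: "card {w::'a. w\<^sup>2 + w = y} = 2" if y: "y \<in> artin_schreier_image" for y
  proof -
    obtain u where u: "y = u\<^sup>2 + u" using y by (auto simp: artin_schreier_image_def)
    have "w\<^sup>2 + w = y \<longleftrightarrow> w = u \<or> w = u + 1" for w
    proof -
      have "(w + u) * (w + (u + 1)) = (w\<^sup>2 + w) + y + 2 * (w * u)"
        unfolding u by algebra
      then have "w\<^sup>2 + w = y \<longleftrightarrow> (w + u) * (w + (u + 1)) = 0"
        using add_eq_zero_iff_char2[OF assms] by (simp add: assms)
      then show ?thesis using add_eq_zero_iff_char2[OF assms] by simp
    qed
    then have "{w. w\<^sup>2 + w = y} = {u, u + 1}" by auto
    then show ?thesis by simp
  qed
  have "CARD('a) = (\<Sum>y\<in>artin_schreier_image. card {w::'a. w\<^sup>2 + w = y})"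
    using sum.image_gen[of "UNIV::'a set" "\<lambda>_. 1::nat" "\<lambda>w. w\<^sup>2 + w"]
    by (simp add: artin_schreier_image_def)
  then show ?thesis by (simp add: fib)
qed

text \<open>
  This is the additivity of the trace: membership in a subgroup of index two behaves like a
  homomorphism to \<open>\<int>/2\<close>.  The case of two elements outside is where the index enters.
\<close>

lemma artin_schreier_add_iff:
  fixes a b :: "'a::{field,finite}"
  assumes "(2::'a) = 0"
  shows "a + b \<in> artin_schreier_image \<longleftrightarrow>
    (a \<in> artin_schreier_image \<longleftrightarrow> b \<in> artin_schreier_image)"
proof -
  let ?A = "artin_schreier_image :: 'a set"
  have twice: "x + (x + y) = y" for x y :: 'a
    using assms by (simp flip: add.assoc mult_2)
  have both_out: "a + b \<in> ?A" if a: "a \<notin> ?A" and b: "b \<notin> ?A"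
  proof -
    \<comment> \<open>The coset \<open>a + A\<close> is disjoint from \<open>A\<close> and just as large, so it is the whole complement.\<close>
    have disj: "?A \<inter> (+) a ` ?A = {}"
    proof (rule ccontr)
      assume "\<not> ?thesis"
      then obtain c where "c \<in> ?A" "a + c \<in> ?A" by auto
      then have "c + (c + a) \<in> ?A"
        using artin_schreier_add[OF assms] by (metis add.commute)
      with a show False by (simp add: twice)
    qed
    have "card (?A \<union> (+) a ` ?A) = CARD('a)"
      using card_artin_schreier[OF assms] disj
      by (subst card_Un_disjoint) (auto simp: card_image)
    then have "?A \<union> (+) a ` ?A = UNIV" by (simp add: card_eq_UNIV_imp_eq_UNIV)
    then obtain c where "c \<in> ?A" "b = a + c" using b by blast
    then show ?thesis by (simp add: twice)
  qed
  show ?thesis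
    using both_out artin_schreier_add[OF assms] twice by (metis add.commute)
qed

lemma artin_schreier_shift_iff:
  fixes w a :: "'a::{field,finite}"
  assumes "(2::'a) = 0"
  shows "(w\<^sup>2 + w) + a \<in> artin_schreier_image \<longleftrightarrow> a \<in> artin_schreier_image"
  using artin_schreier_add_iff[OF assms, of "w\<^sup>2 + w" a] artin_schreierI[of w] by blast

text \<open>
  A solution of \<open>w\<^sup>2 + w = 1\<close> is a primitive cube root of unity, and for odd \<open>m\<close> the field
  has none.
\<close>

lemma one_notin_artin_schreier:
  assumes "odd m" and "CARD('a::{field,finite}) = 2 ^ m"
  shows "(1::'a) \<notin> artin_schreier_image"
proof
  assume "(1::'a) \<in> artin_schreier_image"
  then obtain w :: 'a where w: "1 = w\<^sup>2 + w" by (auto simp: artin_schreier_image_def)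
  have c: "(2::'a) = 0" using two_eq_zero[OF assms(2)] .
  have "w ^ 3 - 1 = (w - 1) * ((w\<^sup>2 + w) + 1)" by algebra
  then have "w ^ 3 = 1" using c by (simp flip: w)
  then have "w = 1"
    using power_inj_of_coprime[of 3 w 1] coprime_3_pow2_odd[OF assms(1)] assms(2) by simp
  with w c show False by simp
qed

lemma artin_schreier_one_add_iff:
  assumes "odd m" and "CARD('a::{field,finite}) = 2 ^ m"
  shows "1 + (a::'a) \<in> artin_schreier_image \<longleftrightarrow> a \<notin> artin_schreier_image"
  using artin_schreier_add_iff[OF two_eq_zero[OF assms(2)], of 1 a]
    one_notin_artin_schreier[OF assms] by blast

section \<open>Fibres through the ratio of two points\<close>

lemma f_map_times_power4:
  fixes x :: "'a::field"
  assumes "x \<noteq> 0"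
  shows "f_map x * x ^ 4 = x ^ 10 + x ^ 5 + 1"
proof -
  have "x powi (-4) * x ^ 4 = 1" using assms by (simp add: power_int_minus)
  moreover have "(a + x ^ 6 + x) * x ^ 4 = a * x ^ 4 + x ^ 10 + x ^ 5" for a
    by (simp add: distrib_right eval_nat_numeral)
  ultimately show ?thesis by (simp add: f_map_def)
qed

text \<open>
  The correction term, twice a polynomial, turns the factorization into an identity that holds
  over the integers; it vanishes in characteristic two.  The later identities use the same device.
\<close>

lemma factorization_char2:
  fixes s p :: "'a::field"
  assumes "(2::'a) = 0"
  shows "s ^ 10 + p\<^sup>2 + p * s ^ 5 - s ^ 6 * (1 + p + p\<^sup>2) =
    (s + 1) * (s ^ 3 + p * s + p) * (s ^ 6 + s ^ 3 * (s\<^sup>2 + s + 1) + p * (s\<^sup>2 + s + 1)\<^sup>2)"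
proof -
  have "(s + 1) * (s ^ 3 + p * s + p) * (s ^ 6 + s ^ 3 * (s\<^sup>2 + s + 1) + p * (s\<^sup>2 + s + 1)\<^sup>2) =
      s ^ 10 + p\<^sup>2 + p * s ^ 5 - s ^ 6 * (1 + p + p\<^sup>2) +
      2 * (s ^ 6 + s ^ 7 + s ^ 8 + s ^ 9
        + p * (s ^ 3 + 3 * s ^ 4 + 4 * s ^ 5 + 5 * s ^ 6 + 3 * s ^ 7 + s ^ 8)
        + p\<^sup>2 * (2 * s + 4 * s\<^sup>2 + 5 * s ^ 3 + 4 * s ^ 4 + 2 * s ^ 5 + s ^ 6))"
    by algebra
  then show ?thesis by (simp only: assms mult_zero_left add_0_right)
qed

lemma f_map_divide_eq_iff:
  fixes x s :: "'a::field"
  assumes "(2::'a) = 0" and "x \<noteq> 0" and "s \<noteq> 0"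
  shows "f_map (x / s) = f_map x \<longleftrightarrow>
    (s + 1) * (s ^ 3 + x ^ 5 * s + x ^ 5) *
      (s ^ 6 + s ^ 3 * (s\<^sup>2 + s + 1) + x ^ 5 * (s\<^sup>2 + s + 1)\<^sup>2) = 0"
proof -
  define y where "y = x / s"
  have y: "x = y * s" "y \<noteq> 0" using assms(2,3) by (simp_all add: y_def)
  have "(f_map y - f_map x) * (x ^ 4 * s ^ 6)
      = s ^ 10 * (f_map y * y ^ 4) - s ^ 6 * (f_map x * x ^ 4)"
    unfolding y(1) by (simp add: algebra_simps flip: power_add)
  also have "\<dots> = s ^ 10 * (y ^ 10 + y ^ 5 + 1) - s ^ 6 * (x ^ 10 + x ^ 5 + 1)"
    by (simp only: f_map_times_power4 assms(2) y(2) not_False_eq_True)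
  also have "\<dots> = s ^ 10 + (x ^ 5)\<^sup>2 + x ^ 5 * s ^ 5 - s ^ 6 * (1 + x ^ 5 + (x ^ 5)\<^sup>2)"
    unfolding y(1) by (simp add: algebra_simps power_mult_distrib flip: power_add power_mult)
  also have "\<dots> = (s + 1) * (s ^ 3 + x ^ 5 * s + x ^ 5) *
      (s ^ 6 + s ^ 3 * (s\<^sup>2 + s + 1) + x ^ 5 * (s\<^sup>2 + s + 1)\<^sup>2)"
    by (rule factorization_char2[OF assms(1)])
  finally show ?thesis using assms(2,3) unfolding y_def by (metis eq_iff_diff_eq_0 mult_eq_0_iff power_not_zero)
qed

text \<open>A nonzero zero of \<open>f\<close> would give \<open>(x ^ 5)\<^sup>2 + x ^ 5 = 1\<close>, hence \<open>1 \<in> A\<close>.\<close>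

lemma f_map_eq_zero_iff:
  assumes "odd m" and "CARD('a::{field,finite}) = 2 ^ m"
  shows "f_map (x::'a) = 0 \<longleftrightarrow> x = 0"
proof
  assume fx: "f_map x = 0"
  show "x = 0"
  proof (rule ccontr)
    assume "x \<noteq> 0"
    have c: "(2::'a) = 0" using two_eq_zero[OF assms(2)] .
    have "f_map x * x ^ 4 = (x ^ 5)\<^sup>2 + x ^ 5 + 1"
      using f_map_times_power4[OF \<open>x \<noteq> 0\<close>] by simp
    then have "(x ^ 5)\<^sup>2 + x ^ 5 = 1"
      using fx add_eq_zero_iff_char2[OF c] by simp
    then show False
      using one_notin_artin_schreier[OF assms] artin_schreierI by metis
  qed
qed (simp add: f_map_0)

text \<open>
  With \<open>q = s\<^sup>2 + s + 1\<close>, the sextic is \<open>s ^ 6 + s ^ 3 q + p q\<^sup>2\<close>; dividing by \<open>q\<^sup>2\<close>, which is not zero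
  since \<open>1 \<notin> A\<close>, turns a root into \<open>p = W\<^sup>2 + W\<close> with \<open>W = s ^ 3 / q\<close>.
\<close>

lemma sextic_root_imp_artin_schreier:
  assumes "odd m" and "CARD('a::{field,finite}) = 2 ^ m"
    and root: "s ^ 6 + s ^ 3 * (s\<^sup>2 + s + 1) + p * (s\<^sup>2 + s + 1)\<^sup>2 = (0::'a)"
  shows "p \<in> artin_schreier_image"
proof -
  have c: "(2::'a) = 0" using two_eq_zero[OF assms(2)] .
  define q where "q = s\<^sup>2 + s + 1"
  have "s\<^sup>2 + s \<noteq> 1"
    using one_notin_artin_schreier[OF assms(1,2)] artin_schreierI by metis
  then have q: "q \<noteq> 0" using add_eq_zero_iff_char2[OF c] by (simp add: q_def)
  have "((s ^ 3 / q)\<^sup>2 + s ^ 3 / q) * q\<^sup>2 = s ^ 6 + s ^ 3 * q"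
    using q by (simp add: field_simps power2_eq_square flip: power_add)
  also have "\<dots> = p * q\<^sup>2"
    using root add_eq_zero_iff_char2[OF c] unfolding q_def by blast
  finally have "(s ^ 3 / q)\<^sup>2 + s ^ 3 / q = p" using q by simp
  then show ?thesis using artin_schreierI by metis
qed

text \<open>
  A root \<open>s\<close> of the cubic determines \<open>p = s ^ 3 / (s + 1)\<close>.  In the partial fraction decomposition
  of this expression only \<open>1 + 1 / (s + 1)\<close> matters modulo \<open>A\<close>.
\<close>

lemma cubic_root_param:
  fixes s p :: "'a::field"
  assumes c: "(2::'a) = 0" and "p \<noteq> 0" and root: "s ^ 3 + p * s + p = 0"
  shows "s \<noteq> 0" and "s + 1 \<noteq> 0" and "p * (s + 1) = s ^ 3"
    and "p = (s\<^sup>2 + s) + (1 + 1 / (s + 1))"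
proof -
  have "s ^ 3 + p * (s + 1) = 0" using root by algebra
  then show e: "p * (s + 1) = s ^ 3" using add_eq_zero_iff_char2[OF c] by metis
  show s0: "s \<noteq> 0"
    using e \<open>p \<noteq> 0\<close> by auto
  show s1: "s + 1 \<noteq> 0"
    using e s0 by (metis mult_zero_right power_not_zero)
  have "((s\<^sup>2 + s) + (1 + 1 / (s + 1))) * (s + 1) = (s\<^sup>2 + s + 1) * (s + 1) + 1"
    using s1 by (simp add: distrib_right)
  also have "\<dots> = p * (s + 1) + 2 * (s\<^sup>2 + s + 1)" using e by algebra
  also have "\<dots> = p * (s + 1)" using c by simp
  finally show "p = (s\<^sup>2 + s) + (1 + 1 / (s + 1))" using s1 by simp
qed

text \<open>
  By the preceding lemma, \<open>p\<close> is congruent to \<open>1 + 1 / (s + 1)\<close> modulo \<open>A\<close>, whereas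
  \<open>p / s ^ 5 = 1 / (s\<^sup>2 (s + 1)) = 1 / s\<^sup>2 + 1 / s + 1 / (s + 1)\<close> is congruent to \<open>1 / (s + 1)\<close>;
  the two differ by \<open>1 \<notin> A\<close>.  For \<open>p = x ^ 5\<close>, the quotient is the fifth power of \<open>x / s\<close>.
\<close>

lemma cubic_root_switches_artin_schreier:
  assumes "odd m" and "CARD('a::{field,finite}) = 2 ^ m"
    and "p \<noteq> 0" and root: "s ^ 3 + p * s + p = (0::'a)"
  shows "p / s ^ 5 \<in> artin_schreier_image \<longleftrightarrow> p \<notin> artin_schreier_image"
proof -
  have c: "(2::'a) = 0" using two_eq_zero[OF assms(2)] .
  note s = cubic_root_param[OF c assms(3) root]
  define r where "r = 1 / (s + 1)"
  have r: "r * (s + 1) = 1" using s by (simp add: r_def)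
  have p: "p = (s\<^sup>2 + s) + (1 + r)" using s(4) by (simp add: r_def)
  define t where "t = 1 / s"
  have t: "t * s = 1" using s by (simp add: t_def)
  have "p / s ^ 5 = p * t ^ 5" by (simp add: t_def power_divide)
  also have "\<dots> = (t\<^sup>2 + t) + r"
  proof -
    have "p * t ^ 5 * (s + 1) = (t * s) ^ 3 * t\<^sup>2"
      using s(3) by algebra
    also have "\<dots> + 2 * (t + 1) = ((t\<^sup>2 + t) + r) * (s + 1)"
      using r t by algebra
    finally have "p * t ^ 5 * (s + 1) = ((t\<^sup>2 + t) + r) * (s + 1)"
      using c by simp
    then show ?thesis using s(2) by simp
  qed
  finally have p': "p / s ^ 5 = (t\<^sup>2 + t) + r" .
  show ?thesis
    unfolding p' unfolding p
    by (simp only: artin_schreier_shift_iff[OF c] artin_schreier_one_add_iff[OF assms(1,2)] not_not)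
qed

text \<open>
  Cardano's formula: \<open>a + b\<close> is a root as soon as \<open>a b = p\<close> and \<open>a ^ 3 + b ^ 3 = p\<close>.  The cubes
  \<open>a ^ 3\<close> and \<open>b ^ 3\<close> are then the roots \<open>p w\<close> and \<open>p (w + 1)\<close> of \<open>T\<^sup>2 + p T + p ^ 3\<close>, where
  \<open>p = w\<^sup>2 + w\<close>, and they have cube roots in the field because cubing is a permutation.
\<close>

lemma cubic_root_exists:
  assumes "odd m" and "CARD('a::{field,finite}) = 2 ^ m"
    and "(p::'a) \<in> artin_schreier_image"
  shows "\<exists>s. s ^ 3 + p * s + p = 0"
proof -
  have c: "(2::'a) = 0" using two_eq_zero[OF assms(2)] .
  obtain w where w: "p = w\<^sup>2 + w" using assms(3) by (auto simp: artin_schreier_image_def)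
  have cop: "coprime 3 (CARD('a) - 1)" using coprime_3_pow2_odd[OF assms(1)] assms(2) by simp
  have inj: "inj (\<lambda>x::'a. x ^ 3)" using power_inj_of_coprime[OF cop] by (auto intro: injI)
  then have "surj (\<lambda>x::'a. x ^ 3)" by (simp add: finite_UNIV_inj_surj)
  then obtain a b where a: "p * w = a ^ 3" and b: "p * (w + 1) = b ^ 3"
    by (metis surjE)
  \<comment> \<open>Cube roots being unique, the condition \<open>a b = p\<close> may be checked on cubes.\<close>
  have "(a * b) ^ 3 = p ^ 3" using a b w by algebra
  then have ab: "a * b = p" using power_inj_of_coprime[OF cop] by simp
  have "(a + b) ^ 3 + p * (a + b) + p = 2 * (p * w + p + 2 * (p * (a + b)))"
    using a b ab by algebra
  then have "(a + b) ^ 3 + p * (a + b) + p = 0" using c by simp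
  then show ?thesis by blast
qed

text \<open>
  Given one root \<open>s\<close>, the cubic splits off \<open>S\<^sup>2 + s S + s\<^sup>2 r\<close> with \<open>r = 1 / (s + 1)\<close>, and
  \<open>S = s W\<close> reduces this quadratic to \<open>W\<^sup>2 + W = r\<close>.  Since \<open>p\<close> is congruent to \<open>1 + r\<close> modulo \<open>A\<close>,
  the assumption \<open>p \<notin> A\<close> gives \<open>r \<in> A\<close>, so that the other two roots are in the field as well.
\<close>

lemma cubic_root_count:
  assumes "odd m" and "CARD('a::{field,finite}) = 2 ^ m"
    and "(p::'a) \<notin> artin_schreier_image"
  shows "card {s. s ^ 3 + p * s + p = 0} \<in> {0, 3}"
proof (cases "\<exists>s. s ^ 3 + p * s + p = 0")
  case True
  then obtain s where root: "s ^ 3 + p * s + p = 0" by blast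
  have c: "(2::'a) = 0" using two_eq_zero[OF assms(2)] .
  have p0: "p \<noteq> 0" using assms(3) artin_schreierI[of 0] by auto
  note s = cubic_root_param[OF c p0 root]
  define r where "r = 1 / (s + 1)"
  have r: "r * (s + 1) = 1" using s by (simp add: r_def)
  have p: "p = (s\<^sup>2 + s) + (1 + r)" using s(4) by (simp add: r_def)
  have "r \<in> artin_schreier_image"
    using assms(3) unfolding p
    by (simp only: artin_schreier_shift_iff[OF c] artin_schreier_one_add_iff[OF assms(1,2)] not_not)
  then obtain w where w: "r = w\<^sup>2 + w" by (auto simp: artin_schreier_image_def)
  have "(S + s) * ((S + s * w) * (S + s * (w + 1))) = S ^ 3 + p * S + p" for S
  proof -
    have "(S + s) * ((S + s * w) * (S + s * (w + 1))) = S ^ 3 + p * S + p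
        + 2 * (w * s * S * (S + s) + s * S\<^sup>2 + S * (s\<^sup>2 - p))"
      using s(3) r w by algebra
    then show ?thesis using c by simp
  qed
  note this[symmetric]
  then have "{S. S ^ 3 + p * S + p = 0} = {s, s * w, s * (w + 1)}"
    using add_eq_zero_iff_char2[OF c] by auto
  moreover have "w \<noteq> 1" "w \<noteq> 0" using w r c by auto
  ultimately show ?thesis using s(1) by (simp add: card_insert_if)
qed simp

section \<open>A distinguished point in every fibre\<close>

text \<open>
  A point \<open>x\<close> is called distinguished here if \<open>x ^ 5 \<notin> A\<close>.  Seen from such a point, the sextic factor
  has no root.
\<close>

lemma f_map_eq_iff_of_notin:
  assumes "odd m" and "CARD('a::{field,finite}) = 2 ^ m"
    and x: "(x::'a) ^ 5 \<notin> artin_schreier_image"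
  shows "f_map y = f_map x \<longleftrightarrow>
    (\<exists>s. y = x / s \<and> (s = 1 \<or> s ^ 3 + x ^ 5 * s + x ^ 5 = 0))"
proof -
  have c: "(2::'a) = 0" using two_eq_zero[OF assms(2)] .
  have x0: "x \<noteq> 0" using x artin_schreierI[of "0::'a"] by auto
  have ratio: "f_map (x / s) = f_map x \<longleftrightarrow> s = 1 \<or> s ^ 3 + x ^ 5 * s + x ^ 5 = 0"
    if "s \<noteq> 0" for s
    using f_map_divide_eq_iff[OF c x0 that] sextic_root_imp_artin_schreier[OF assms(1,2), of s "x ^ 5"]
      x add_eq_zero_iff_char2[OF c] by auto
  show ?thesis
  proof
    assume eq: "f_map y = f_map x"
    then have y0: "y \<noteq> 0" using f_map_eq_zero_iff[OF assms(1,2)] x0 by metis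
    have y: "y = x / (x / y)" using x0 by simp
    then show "\<exists>s. y = x / s \<and> (s = 1 \<or> s ^ 3 + x ^ 5 * s + x ^ 5 = 0)"
      using ratio[of "x / y"] eq x0 y0 by (metis divide_eq_0_iff)
  next
    assume "\<exists>s. y = x / s \<and> (s = 1 \<or> s ^ 3 + x ^ 5 * s + x ^ 5 = 0)"
    then obtain s where s: "y = x / s" "s = 1 \<or> s ^ 3 + x ^ 5 * s + x ^ 5 = 0" by blast
    then have "s \<noteq> 0" using x0 by auto
    then show "f_map y = f_map x" using ratio s by blast
  qed
qed

text \<open>
  If \<open>x\<close> itself is not distinguished, then \<open>x / s\<close> is, for a root \<open>s\<close> of the cubic.
\<close>

lemma distinguished_point_exists:
  assumes "odd m" and "CARD('a::{field,finite}) = 2 ^ m" and "(x::'a) \<noteq> 0"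
  shows "\<exists>z. z ^ 5 \<notin> artin_schreier_image \<and> f_map z = f_map x"
proof (cases "x ^ 5 \<in> artin_schreier_image")
  case True
  have c: "(2::'a) = 0" using two_eq_zero[OF assms(2)] .
  have p0: "x ^ 5 \<noteq> 0" using assms(3) by simp
  obtain s where root: "s ^ 3 + x ^ 5 * s + x ^ 5 = 0"
    using cubic_root_exists[OF assms(1,2) True] by blast
  have "s \<noteq> 0" using cubic_root_param[OF c p0 root] by blast
  then have "f_map (x / s) = f_map x"
    using f_map_divide_eq_iff[OF c assms(3)] root by simp
  moreover have "(x / s) ^ 5 \<notin> artin_schreier_image"
    using cubic_root_switches_artin_schreier[OF assms(1,2) p0 root] True
    by (simp add: power_divide)
  ultimately show ?thesis by blast
qed blast

text \<open>
  For a distinguished \<open>x\<close>, every other point of its fibre is \<open>x / s\<close> with a root \<open>s\<close> of the cubic,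
  and passing from \<open>x\<close> to \<open>x / s\<close> switches membership in \<open>A\<close>.
\<close>

lemma distinguished_point_unique:
  assumes "odd m" and "CARD('a::{field,finite}) = 2 ^ m"
    and x: "(x::'a) ^ 5 \<notin> artin_schreier_image" and y: "y ^ 5 \<notin> artin_schreier_image"
    and eq: "f_map y = f_map x"
  shows "y = x"
proof -
  have x0: "x ^ 5 \<noteq> 0" using x artin_schreierI[of "0::'a"] by auto
  obtain s where s: "y = x / s" "s = 1 \<or> s ^ 3 + x ^ 5 * s + x ^ 5 = 0"
    using f_map_eq_iff_of_notin[OF assms(1-3)] eq by blast
  have "y ^ 5 = x ^ 5 / s ^ 5" unfolding s(1) by (rule power_divide)
  then have "\<not> s ^ 3 + x ^ 5 * s + x ^ 5 = 0"
    using cubic_root_switches_artin_schreier[OF assms(1,2) x0] x y by metis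
  then show ?thesis using s by simp
qed

lemma card_fibre_of_notin:
  assumes "odd m" and "CARD('a::{field,finite}) = 2 ^ m"
    and x: "(x::'a) ^ 5 \<notin> artin_schreier_image"
  shows "card {y. f_map y = f_map x} \<in> {1, 4}"
proof -
  let ?R = "{s. s ^ 3 + x ^ 5 * s + x ^ 5 = 0}"
  have c: "(2::'a) = 0" using two_eq_zero[OF assms(2)] .
  have x0: "x \<noteq> 0" using x artin_schreierI[of "0::'a"] by auto
  have "{y. f_map y = f_map x} = (\<lambda>s. x / s) ` insert 1 ?R"
    using f_map_eq_iff_of_notin[OF assms] by auto
  moreover have "inj_on (\<lambda>s. x / s) (insert 1 ?R)"
    using x0 by (auto intro!: inj_onI simp: divide_inverse)
  ultimately have "card {y. f_map y = f_map x} = card (insert 1 ?R)"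
    by (simp only: card_image)
  moreover have "1 \<notin> ?R"
    using cubic_root_param(2)[OF c, of "x ^ 5" 1] c x0 by auto
  ultimately show ?thesis
    using cubic_root_count[OF assms] by auto
qed

lemma card_distinguished:
  assumes "odd m" and "CARD('a::{field,finite}) = 2 ^ m"
  shows "card {x::'a. x ^ 5 \<notin> artin_schreier_image} = 2 ^ (m - 1)"
proof -
  let ?A = "artin_schreier_image :: 'a set"
  have c: "(2::'a) = 0" using two_eq_zero[OF assms(2)] .
  have cop: "coprime 5 (CARD('a) - 1)" using coprime_5_pow2_odd[OF assms(1)] assms(2) by simp
  have inj: "inj (\<lambda>x::'a. x ^ 5)" using power_inj_of_coprime[OF cop] by (auto intro: injI)
  then have "bij (\<lambda>x::'a. x ^ 5)" by (simp add: bij_def finite_UNIV_inj_surj)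
  then have "card ((\<lambda>x::'a. x ^ 5) -` (- ?A)) = card (- ?A)"
    by (metis bij_def card_vimage_inj top_greatest)
  moreover have "card (- ?A) = CARD('a) - card ?A" by (simp add: Compl_eq_Diff_UNIV card_Diff_subset)
  moreover have "2 * 2 ^ (m - 1) = (2::nat) ^ m"
    using assms(1) by (metis odd_pos power_eq_if less_numeral_extra(3))
  ultimately show ?thesis
    using card_artin_schreier[OF c] assms(2) by (simp add: vimage_def)
qed

theorem theorem16:
  fixes m :: nat
  assumes "odd m"
    and "CARD('a::{field,finite}) = 2 ^ m"
  shows "zero_one_map 4 (f_map :: 'a \<Rightarrow> 'a) UNIV UNIV
    \<and> card (D_star (f_map :: 'a \<Rightarrow> 'a)) = 2 ^ (m - 1)"
proof
  let ?B = "{x::'a. x ^ 5 \<notin> artin_schreier_image}"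
  note zero = f_map_eq_zero_iff[OF assms]
  show "zero_one_map 4 (f_map :: 'a \<Rightarrow> 'a) UNIV UNIV"
    unfolding zero_one_map_def
  proof (intro conjI ballI)
    fix y :: 'a
    show "card {x \<in> UNIV. f_map x = y} \<in> {0, 1, 4}"
    proof (cases "\<exists>x. f_map x = y")
      case True
      then obtain x where x: "f_map x = y" by blast
      show ?thesis
      proof (cases "x = 0")
        case True
        then have "{x \<in> UNIV. f_map x = y} = {0}" using x zero by (auto simp: f_map_0)
        then show ?thesis by simp
      next
        case False
        then obtain z where "z \<in> ?B" "f_map z = y"
          using distinguished_point_exists[OF assms False] x by auto
        then show ?thesis using card_fibre_of_notin[OF assms, of z] by auto
      qed
    qed simp
  qed auto
  have "0 \<notin> ?B" using artin_schreierI[of "0::'a"] by auto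
  then have "D_star f_map = f_map ` ?B"
    using zero distinguished_point_exists[OF assms]
    unfolding D_star_def by (auto simp: image_iff) metis+
  moreover have "inj_on f_map ?B"
    using distinguished_point_unique[OF assms] by (auto intro!: inj_onI)
  ultimately show "card (D_star (f_map :: 'a \<Rightarrow> 'a)) = 2 ^ (m - 1)"
    using card_distinguished[OF assms] by (simp add: card_image)
qed

end
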